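(* For each $x\in\mathcal X$ let $\bar F_{Y|X=x}$ be regularly varying at infinity with index $-1/\gamma_F(x)$, with Karamata representation $$\bar F_{Y|X=x}(y)=c(x,y)\exp\Big(\int_1^y\delta(x,s)/s\,ds\Big),$$ where $c(x,y)\to c(x)\in(0,\infty)$ and $\delta(x,y)\to\delta(x)=-1/\gamma_F(x)$ as $y\to\infty$, both convergences being uniform in $x\in\mathcal X$. Further assume $\inf_{x\in\mathcal X}c(x)>0$. Then for all $\epsilon_a>0$ and $\epsilon_c>0$ there exists $N$ such that for $t>N$ $$(1-\epsilon_c)y^{-1/\gamma_F(x)-\epsilon_a}\le\frac{\bar F_{Y|X=x}(ty)}{\bar F_{Y|X=x}(t)}\le(1+\epsilon_c)y^{-1/\gamma_F(x)+\epsilon_a}$$ for all $x\in\mathcal X$ and $y>1$.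
   Context: $(Y,X)$ is a random vector with $Y$ real-valued and $X\in\mathcal X\subset\mathbb R^m$; $\bar F_{Y|X=x}(y)=\mathbb P(Y>y|X=x)$; $\gamma_F(x)\in[\gamma_F^L,\gamma_F^U]$ for all $x\in\mathcal X$, with $0<\gamma_F^L<\gamma_F^U<\infty$. The functions $c,\delta$ are measurable. *)

theory Defs
  imports "HOL-Probability.Probability"
begin

text \<open>\<open>K\<close> is a version of the regular conditional distribution of \<open>Y\<close> given \<open>X\<close>.\<close>

definition regular_cond_dist ::
  "'a measure \<Rightarrow> 'b measure \<Rightarrow> 'c measure \<Rightarrow> ('a \<Rightarrow> 'b) \<Rightarrow> ('a \<Rightarrow> 'c) \<Rightarrow> ('b \<Rightarrow> 'c measure) \<Rightarrow> bool"
  where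
  "regular_cond_dist M N L X Y K \<longleftrightarrow>
     K \<in> N \<rightarrow>\<^sub>M prob_algebra L \<and>
     (\<forall>A\<in>sets N. \<forall>B\<in>sets L.
        emeasure M {\<omega> \<in> space M. X \<omega> \<in> A \<and> Y \<omega> \<in> B} =
          (\<integral>\<^sup>+x\<in>A. emeasure (K x) B \<partial>distr M N X))"

definition cond_survival :: "('b \<Rightarrow> real measure) \<Rightarrow> 'b \<Rightarrow> real \<Rightarrow> real" where
  "cond_survival K x y = measure (K x) {y<..}"

definition regularly_varying :: "(real \<Rightarrow> real) \<Rightarrow> real \<Rightarrow> bool" where
  "regularly_varying f \<alpha> \<longleftrightarrow>
     (\<exists>a. f \<in> borel_measurable (restrict_space borel {a..}) \<and> (\<forall>t\<ge>a. f t > 0)) \<and>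
     (\<forall>y>0. ((\<lambda>t. f (t * y) / f t) \<longlongrightarrow> y powr \<alpha>) at_top)"

text \<open>The integrability clause says that the integral in the representation exists; the
  Lebesgue integral of a non-integrable function is \<open>0\<close> by convention.\<close>

definition karamata_representation ::
  "(real \<Rightarrow> real) \<Rightarrow> (real \<Rightarrow> real) \<Rightarrow> (real \<Rightarrow> real) \<Rightarrow> bool" where
  "karamata_representation f c \<delta> \<longleftrightarrow>
     (\<forall>y\<ge>1. set_integrable lborel {1..y} (\<lambda>s. \<delta> s / s) \<and>
            f y = c y * exp (LINT s:{1..y}|lborel. \<delta> s / s))"

end

theory Submission
  imports Defs
begin

text \<open>The representation gives
  \<open>F (t y) / F t = c (t y) / c t * exp (\<integral>\<^bsub>t\<^esub>\<^bsup>t y\<^esup> \<delta> s / s ds)\<close>. Once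
  \<open>\<bar>\<delta> - \<alpha>\<bar> \<le> \<epsilon>\<^sub>a\<close> on \<open>[t, \<infinity>)\<close>, the exponential lies between
  \<open>y powr (\<alpha> - \<epsilon>\<^sub>a)\<close> and \<open>y powr (\<alpha> + \<epsilon>\<^sub>a)\<close>. A positive lower bound on the limits \<open>c x\<close> turns the
  uniform absolute convergence of \<open>c\<close> into uniform relative convergence, so that the
  prefactor is uniformly close to 1.\<close>

lemma has_integral_divide_self:
  fixes a b k :: real
  assumes "0 < a" "a \<le> b"
  shows "((\<lambda>s. k / s) has_integral k * ln (b / a)) {a..b}"
proof -
  have "((\<lambda>s. k / s) has_integral k * ln b - k * ln a) {a..b}"
  proof (rule fundamental_theorem_of_calculus[OF assms(2)])
    fix s assume "s \<in> {a..b}"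
    with assms have "0 < s" by simp
    then have "((\<lambda>s. k * ln s) has_real_derivative k / s) (at s within {a..b})"
      by (auto intro!: derivative_eq_intros)
    then show "((\<lambda>s. k * ln s) has_vector_derivative k / s) (at s within {a..b})"
      by (simp add: has_real_derivative_iff_has_vector_derivative)
  qed
  then show ?thesis using assms by (simp add: ln_div algebra_simps)
qed

text \<open>The integral from 1 splits at \<open>t\<close>, and the part over \<open>{1..t}\<close>
  cancels. Passing from the Lebesgue to the gauge integral gives access to interval additivity and
  the fundamental theorem of calculus. If \<open>c t = 0\<close>, both sides are 0 by the convention
  on division by zero.\<close>

lemma karamata_representation_ratio:
  assumes rep: "karamata_representation f c \<delta>" and t: "1 \<le> t" "t \<le> u"
  shows "f u / f t = c u / c t * exp (integral {t..u} (\<lambda>s. \<delta> s / s))"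
    and "(\<lambda>s. \<delta> s / s) integrable_on {t..u}"
proof -
  let ?g = "\<lambda>s. \<delta> s / s"
  have int: "?g integrable_on {1..y}" and eq: "f y = c y * exp (integral {1..y} ?g)"
    if "1 \<le> y" for y
  proof -
    have g: "set_integrable lborel {1..y} ?g"
      and fy: "f y = c y * exp (LINT s:{1..y}|lborel. ?g s)"
      using rep that unfolding karamata_representation_def by blast+
    show "?g integrable_on {1..y}" by (rule set_borel_integral_eq_integral(1)[OF g])
    show "f y = c y * exp (integral {1..y} ?g)"
      unfolding fy set_borel_integral_eq_integral(2)[OF g] ..
  qed
  have u: "1 \<le> u" using t by simp
  show "?g integrable_on {t..u}"
    by (rule integrable_subinterval_real[OF int[OF u]]) (use t in simp)
  have "integral {1..u} ?g = integral {1..t} ?g + integral {t..u} ?g"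
    by (rule Henstock_Kurzweil_Integration.integral_combine[OF t int[OF u], symmetric])
  then have "f u = c u * (exp (integral {1..t} ?g) * exp (integral {t..u} ?g))"
    by (simp only: eq[OF u] exp_add)
  then show "f u / f t = c u / c t * exp (integral {t..u} ?g)"
    by (simp only: eq[OF t(1)]) (simp add: divide_simps)
qed

text \<open>The tolerance k = e / (2 + e) solves (1 + k) / (1 - k) = 1 + e, the largest possible
  quotient. The smallest is 1 / (1 + e), which is at least 1 - e.\<close>

lemma quotient_relative_bounds:
  fixes u v C e :: real
  assumes "0 < e" "0 < C"
    and u: "\<bar>u - C\<bar> \<le> e / (2 + e) * C" and v: "\<bar>v - C\<bar> \<le> e / (2 + e) * C"
  shows "0 < u / v" "1 - e \<le> u / v" "u / v \<le> 1 + e"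
proof -
  \<comment> \<open>\<open>D\<close> and \<open>(1 + e) * D\<close> are the endpoints of the
    interval that contains \<open>u\<close> and \<open>v\<close>.\<close>
  define k D where "k = e / (2 + e) * C" and "D = 2 / (2 + e) * C"
  have D: "0 < D" using assms by (simp add: D_def)
  have "C - k = D" "C + k = (1 + e) * D"
    using assms(1) by (simp_all add: k_def D_def field_simps)
  then have b: "D \<le> u" "u \<le> (1 + e) * D" "D \<le> v" "v \<le> (1 + e) * D"
    using u v unfolding k_def[symmetric] abs_le_iff by linarith+
  then show "0 < u / v" using D by simp
  have "(1 + e) * D \<le> (1 + e) * v" using b assms(1) by simp
  with b D show "u / v \<le> 1 + e" by (simp add: divide_le_eq)
  show "1 - e \<le> u / v"
  \<comment> \<open>Multiplying \<open>v \<le> (1 + e) * D\<close> by \<open>1 - e\<close> preserves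
    the inequality only if \<open>e \<le> 1\<close>; otherwise the claimed lower bound is
    negative.\<close>
  proof (cases "e \<le> 1")
    case True
    then have "(1 - e) * v \<le> (1 - e) * ((1 + e) * D)"
      using b by (intro mult_left_mono) auto
    also have "\<dots> = D - e\<^sup>2 * D" by (simp add: algebra_simps power2_eq_square)
    also have "\<dots> \<le> u" using b D by (auto intro: order_trans[of _ D])
    finally show ?thesis using b D by (simp add: le_divide_eq)
  next
    case False
    with \<open>0 < u / v\<close> show ?thesis by linarith
  qed
qed

text \<open>This is the estimate for one fixed \<open>x\<close>. Its hypotheses involve
  \<open>t\<close>, \<open>e\<close> and \<open>d\<close> only through closeness on
  \<open>[t, \<infinity>)\<close>, so one threshold can serve all \<open>x\<close> at once.\<close>

lemma karamata_potter_bounds: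
  assumes rep: "karamata_representation f c \<delta>" and "1 \<le> t" "1 < y" and "0 < e" "0 < C"
    and c: "\<And>s. t \<le> s \<Longrightarrow> \<bar>c s - C\<bar> \<le> e / (2 + e) * C"
    and \<delta>: "\<And>s. t \<le> s \<Longrightarrow> \<bar>\<delta> s - \<alpha>\<bar> \<le> d"
  shows "(1 - e) * y powr (\<alpha> - d) \<le> f (t * y) / f t"
    and "f (t * y) / f t \<le> (1 + e) * y powr (\<alpha> + d)"
proof -
  have le: "t \<le> t * y" using \<open>1 \<le> t\<close> \<open>1 < y\<close> by simp
  define I where "I = integral {t..t * y} (\<lambda>s. \<delta> s / s)"
  define r where "r = c (t * y) / c t"
  have ratio: "f (t * y) / f t = r * exp I"
    unfolding r_def I_def by (rule karamata_representation_ratio[OF rep \<open>1 \<le> t\<close> le])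
  have r: "0 < r" "1 - e \<le> r" "r \<le> 1 + e"
    unfolding r_def using quotient_relative_bounds[OF \<open>0 < e\<close> \<open>0 < C\<close> c[OF le] c[OF order_refl]]
    by auto
  have I: "((\<lambda>s. \<delta> s / s) has_integral I) {t..t * y}"
    unfolding I_def
    by (rule integrable_integral[OF karamata_representation_ratio(2)[OF rep \<open>1 \<le> t\<close> le]])
  \<comment> \<open>The factor \<open>t\<close> cancels inside the logarithm, so the comparison
    integrals yield powers of \<open>y\<close> alone.\<close>
  have k: "((\<lambda>s. k / s) has_integral k * ln y) {t..t * y}" for k :: real
    using has_integral_divide_self[of t "t * y" k] le \<open>1 \<le> t\<close> by simp
  have "(\<alpha> - d) * ln y \<le> I"
  proof (rule has_integral_le[OF k I])
    fix s assume "s \<in> {t..t * y}"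
    then show "(\<alpha> - d) / s \<le> \<delta> s / s"
      using \<delta>[of s] \<open>1 \<le> t\<close> by (intro divide_right_mono) auto
  qed
  then have lower: "y powr (\<alpha> - d) \<le> exp I" using \<open>1 < y\<close> by (simp add: powr_def)
  have "I \<le> (\<alpha> + d) * ln y"
  proof (rule has_integral_le[OF I k])
    fix s assume "s \<in> {t..t * y}"
    then show "\<delta> s / s \<le> (\<alpha> + d) / s"
      using \<delta>[of s] \<open>1 \<le> t\<close> by (intro divide_right_mono) auto
  qed
  then have upper: "exp I \<le> y powr (\<alpha> + d)" using \<open>1 < y\<close> by (simp add: powr_def)
  \<comment> \<open>The factors are replaced one at a time, each against a nonnegative one, so the
    sign of \<open>1 - e\<close> does not matter.\<close>
  have "(1 - e) * y powr (\<alpha> - d) \<le> r * y powr (\<alpha> - d)"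
    using r by (intro mult_right_mono) auto
  also have "\<dots> \<le> r * exp I" using r lower by simp
  finally show "(1 - e) * y powr (\<alpha> - d) \<le> f (t * y) / f t" by (simp add: ratio)
  show "f (t * y) / f t \<le> (1 + e) * y powr (\<alpha> + d)"
    unfolding ratio using r upper \<open>0 < e\<close> by (intro mult_mono) auto
qed

theorem theorem7:
  fixes M :: "'a measure"
    and Y :: "'a \<Rightarrow> real"
    and X :: "'a \<Rightarrow> real ^ 'm"
    and S :: "(real ^ 'm) set"
    and K :: "real ^ 'm \<Rightarrow> real measure"
    and \<gamma> :: "real ^ 'm \<Rightarrow> real"
    and \<gamma>L \<gamma>U :: real
    and c \<delta> :: "real ^ 'm \<Rightarrow> real \<Rightarrow> real"
    and c_lim :: "real ^ 'm \<Rightarrow> real"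
  assumes "prob_space M"
    and "X \<in> M \<rightarrow>\<^sub>M restrict_space borel S"
    and "Y \<in> borel_measurable M"
    and "regular_cond_dist M (restrict_space borel S) borel X Y K"
    and "0 < \<gamma>L" and "\<gamma>L < \<gamma>U"
    and "\<forall>x\<in>S. \<gamma> x \<in> {\<gamma>L..\<gamma>U}"
    and "(\<lambda>(x, y). c x y) \<in> borel_measurable (restrict_space borel (S \<times> {1..}))"
    and "(\<lambda>(x, y). \<delta> x y) \<in> borel_measurable (restrict_space borel (S \<times> {1..}))"
    and "\<forall>x\<in>S. regularly_varying (cond_survival K x) (- 1 / \<gamma> x)"
    and "\<forall>x\<in>S. karamata_representation (cond_survival K x) (c x) (\<delta> x)"
    and "\<forall>x\<in>S. c_lim x > 0"
    and "uniform_limit S (\<lambda>y x. c x y) c_lim at_top"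
    and "uniform_limit S (\<lambda>y x. \<delta> x y) (\<lambda>x. - 1 / \<gamma> x) at_top"
    and "(INF x\<in>S. c_lim x) > 0"
  shows "\<forall>\<epsilon>\<^sub>a>0. \<forall>\<epsilon>\<^sub>c>0. \<exists>N::real. \<forall>t>N. \<forall>x\<in>S. \<forall>y>1.
           (1 - \<epsilon>\<^sub>c) * y powr (- 1 / \<gamma> x - \<epsilon>\<^sub>a)
             \<le> cond_survival K x (t * y) / cond_survival K x t \<and>
           cond_survival K x (t * y) / cond_survival K x t
             \<le> (1 + \<epsilon>\<^sub>c) * y powr (- 1 / \<gamma> x + \<epsilon>\<^sub>a)"
proof (intro allI impI)
  fix \<epsilon>\<^sub>a \<epsilon>\<^sub>c :: real
  assume "0 < \<epsilon>\<^sub>a" "0 < \<epsilon>\<^sub>c"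
  define m where "m = (INF x\<in>S. c_lim x)"
  have m: "0 < m" using assms(15) by (simp add: m_def)
  have m_le: "m \<le> c_lim x" if "x \<in> S" for x
    unfolding m_def using that assms(12) by (intro cINF_lower bdd_belowI2[of _ 0]) auto
  let ?q = "\<epsilon>\<^sub>c / (2 + \<epsilon>\<^sub>c)"
  have q: "0 < ?q" using \<open>0 < \<epsilon>\<^sub>c\<close> by simp
  \<comment> \<open>Uniform convergence needs a tolerance free of \<open>x\<close>;
    \<open>?q * m\<close> is at most the relative tolerance \<open>?q * c_lim x\<close> for every
    \<open>x\<close>.\<close>
  have "\<forall>\<^sub>F s in at_top. \<forall>x\<in>S. dist (c x s) (c_lim x) < ?q * m"
    using m q by (intro uniform_limitD[OF assms(13)] mult_pos_pos)
  then obtain N1 where N1: "\<forall>s\<ge>N1. \<forall>x\<in>S. dist (c x s) (c_lim x) < ?q * m"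
    unfolding eventually_at_top_linorder ..
  obtain N2 where N2: "\<forall>s\<ge>N2. \<forall>x\<in>S. dist (\<delta> x s) (- 1 / \<gamma> x) < \<epsilon>\<^sub>a"
    using uniform_limitD[OF assms(14) \<open>0 < \<epsilon>\<^sub>a\<close>] unfolding eventually_at_top_linorder ..
  show "\<exists>N. \<forall>t>N. \<forall>x\<in>S. \<forall>y>1.
      (1 - \<epsilon>\<^sub>c) * y powr (- 1 / \<gamma> x - \<epsilon>\<^sub>a) \<le> cond_survival K x (t * y) / cond_survival K x t \<and>
      cond_survival K x (t * y) / cond_survival K x t \<le> (1 + \<epsilon>\<^sub>c) * y powr (- 1 / \<gamma> x + \<epsilon>\<^sub>a)"
  proof (intro exI allI impI ballI)
    fix t x and y :: real
    \<comment> \<open>This fixes the witness for \<open>N\<close>. The entry 1 puts \<open>t\<close>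
      where the representation holds; \<open>N1\<close> and \<open>N2\<close> control
      \<open>c\<close> and \<open>\<delta>\<close>.\<close>
    assume t: "max 1 (max N1 N2) < t" and "x \<in> S" "1 < y"
    have c: "\<bar>c x s - c_lim x\<bar> \<le> ?q * c_lim x" if "t \<le> s" for s
    proof -
      have "\<bar>c x s - c_lim x\<bar> \<le> ?q * m"
        using N1[rule_format, of s x] that t \<open>x \<in> S\<close> by (simp add: dist_real_def)
      also have "\<dots> \<le> ?q * c_lim x" using m_le[OF \<open>x \<in> S\<close>] q by (intro mult_left_mono) auto
      finally show ?thesis .
    qed
    have \<delta>: "\<bar>\<delta> x s - (- 1 / \<gamma> x)\<bar> \<le> \<epsilon>\<^sub>a" if "t \<le> s" for s
      using N2[rule_format, of s x] that t \<open>x \<in> S\<close> unfolding dist_real_def by linarith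
    have rep: "karamata_representation (cond_survival K x) (c x) (\<delta> x)"
      and "0 < c_lim x" "1 \<le> t"
      using assms(11,12) \<open>x \<in> S\<close> t by auto
    show "(1 - \<epsilon>\<^sub>c) * y powr (- 1 / \<gamma> x - \<epsilon>\<^sub>a) \<le> cond_survival K x (t * y) / cond_survival K x t \<and>
        cond_survival K x (t * y) / cond_survival K x t \<le> (1 + \<epsilon>\<^sub>c) * y powr (- 1 / \<gamma> x + \<epsilon>\<^sub>a)"
      by (intro conjI karamata_potter_bounds[OF rep \<open>1 \<le> t\<close> \<open>1 < y\<close> \<open>0 < \<epsilon>\<^sub>c\<close> \<open>0 < c_lim x\<close>] c \<delta>)
  qed
qed

end
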